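(* A finite multisemigroup $(S,* )$ is nilpotent if and only if for any (non-empty) submultisemigroup $T$ of $S$ we have $|T*T|<|T|$ (or, equivalently, $T*T\neq T$).
   Context: A multisemigroup is a pair $(S,* )$ with $S$ a non-empty set and $*:S\times S\to 2^S$ a map such that $(a*b)*c=a*(b*c)$ for all $a,b,c\in S$, where for $A,B\subset S$ one puts $A*B:=\bigcup_{a\in A,b\in B}a*b$ and an element is identified with the corresponding singleton. A submultisemigroup is a non-empty subset $T\subset S$ with $a*b\subset T$ for all $a,b\in T$. $S$ is nilpotent if $S^k=\varnothing$ for some $k\in\mathbb{N}$, where $S^k$ is the union of all products $x_1*\dots*x_k$ with $x_i\in S$. *)

theory Defs
  imports Main
begin

definition set_mult :: "('a \<Rightarrow> 'a \<Rightarrow> 'a set) \<Rightarrow> 'a set \<Rightarrow> 'a set \<Rightarrow> 'a set" where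
  "set_mult mul A B = (\<Union>a\<in>A. \<Union>b\<in>B. mul a b)"

locale multisemigroup =
  fixes S :: "'a set" and mul :: "'a \<Rightarrow> 'a \<Rightarrow> 'a set"
  assumes carrier_nonempty: "S \<noteq> {}"
    and mul_closed: "\<And>a b. a \<in> S \<Longrightarrow> b \<in> S \<Longrightarrow> mul a b \<subseteq> S"
    and mul_assoc: "\<And>a b c. a \<in> S \<Longrightarrow> b \<in> S \<Longrightarrow> c \<in> S \<Longrightarrow>
          set_mult mul (mul a b) {c} = set_mult mul {a} (mul b c)"

definition submultisemigroup :: "'a set \<Rightarrow> 'a set \<Rightarrow> ('a \<Rightarrow> 'a \<Rightarrow> 'a set) \<Rightarrow> bool" where
  "submultisemigroup T S mul \<longleftrightarrow>
     T \<noteq> {} \<and> T \<subseteq> S \<and> (\<forall>a\<in>T. \<forall>b\<in>T. mul a b \<subseteq> T)"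

text \<open>A product of elements, given as its first factor and the list of the remaining ones
  (so there is no empty product), bracketed to the left: \<open>(\<dots>((x * y\<^sub>1) * y\<^sub>2) \<dots>) * y\<^sub>n\<close>.
  By associativity the bracketing is immaterial.\<close>

definition elem_prod :: "('a \<Rightarrow> 'a \<Rightarrow> 'a set) \<Rightarrow> 'a \<Rightarrow> 'a list \<Rightarrow> 'a set" where
  "elem_prod mul x ys = foldl (\<lambda>A y. set_mult mul A {y}) {x} ys"

text \<open>Only exponents \<open>k \<ge> 1\<close> are meaningful; for \<open>k = 0\<close> the union is over no products at all,
  hence empty.\<close>

definition ms_power :: "'a set \<Rightarrow> ('a \<Rightarrow> 'a \<Rightarrow> 'a set) \<Rightarrow> nat \<Rightarrow> 'a set" where
  "ms_power S mul k =
     \<Union> {elem_prod mul x ys | x ys. x \<in> S \<and> set ys \<subseteq> S \<and> length (x # ys) = k}"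

text \<open>The condition \<open>k \<ge> 1\<close> is essential because of the degenerate value at \<open>k = 0\<close>.\<close>

definition ms_nilpotent :: "'a set \<Rightarrow> ('a \<Rightarrow> 'a \<Rightarrow> 'a set) \<Rightarrow> bool" where
  "ms_nilpotent S mul \<longleftrightarrow> (\<exists>k\<ge>1. ms_power S mul k = {})"

end

theory Submission
  imports Defs
begin

text \<open>
  The powers of \<open>S\<close> with positive exponent satisfy \<open>S\<^sup>k\<^sup>+\<^sup>1 = S\<^sup>k * S\<close> and therefore form a decreasing chain, which becomes
  stationary because \<open>S\<close> is finite: some \<open>T = S\<^sup>k\<close> satisfies \<open>T * S = T\<close>. Multiplying by \<open>S\<close>
  repeatedly gives \<open>T = T * S\<^sup>k = T * T\<close>. If \<open>S\<close> is not nilpotent, then \<open>T\<close> is non-empty, hence an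
  idempotent submultisemigroup (\<open>ex_idempotent_power\<close>). Conversely, an idempotent
  submultisemigroup \<open>T\<close> equals all of its powers, and these lie inside the powers of \<open>S\<close>, so no
  power of \<open>S\<close> is empty (\<open>idempotent_subset_power\<close>). Finally, \<open>T * T \<subseteq> T\<close> for every
  submultisemigroup, so for finite \<open>T\<close> the condition \<open>T * T \<noteq> T\<close> is the same as a strict
  inequality of cardinalities.
\<close>

lemma set_mult_mono:
  assumes "A \<subseteq> A'" and "B \<subseteq> B'"
  shows "set_mult mul A B \<subseteq> set_mult mul A' B'"
  using assms unfolding set_mult_def by blast

lemma elem_prod_snoc: "elem_prod mul x (ys @ [y]) = set_mult mul (elem_prod mul x ys) {y}"
  by (simp add: elem_prod_def)

lemma ms_power_1: "ms_power S mul (Suc 0) = S"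
  unfolding ms_power_def by (auto simp: elem_prod_def)

text \<open>Products are bracketed to the left, so splitting off the last factor of a product of \<open>n + 2\<close>
  factors leaves a product of \<open>n + 1\<close> factors. The shift by two keeps the exponent on the right
  positive, as the zeroth power is empty rather than a unit.\<close>

lemma ms_power_Suc_Suc:
  "ms_power S mul (Suc (Suc n)) = set_mult mul (ms_power S mul (Suc n)) S"
proof (intro equalityI subsetI)
  fix z assume "z \<in> ms_power S mul (Suc (Suc n))"
  then obtain x ys where xys: "x \<in> S" "set ys \<subseteq> S" "length ys = Suc n" "z \<in> elem_prod mul x ys"
    unfolding ms_power_def by auto
  obtain zs y where ys: "ys = zs @ [y]"
    using xys(3) by (cases ys rule: rev_cases) auto
  have "elem_prod mul x zs \<subseteq> ms_power S mul (Suc n)"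
    using xys(1-3) unfolding ys ms_power_def by (intro Union_upper CollectI exI[of _ x] exI[of _ zs]) simp
  moreover have "{y} \<subseteq> S"
    using xys(2) ys by simp
  ultimately have "set_mult mul (elem_prod mul x zs) {y} \<subseteq> set_mult mul (ms_power S mul (Suc n)) S"
    by (rule set_mult_mono)
  then show "z \<in> set_mult mul (ms_power S mul (Suc n)) S"
    using xys(4) unfolding ys elem_prod_snoc by (rule subsetD)
next
  fix z assume "z \<in> set_mult mul (ms_power S mul (Suc n)) S"
  then obtain u y where uy: "u \<in> ms_power S mul (Suc n)" "y \<in> S" "z \<in> mul u y"
    unfolding set_mult_def by blast
  from uy(1) obtain x ys where xys: "x \<in> S" "set ys \<subseteq> S" "length ys = n" "u \<in> elem_prod mul x ys"
    unfolding ms_power_def by auto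
  have "z \<in> elem_prod mul x (ys @ [y])"
    using xys(4) uy(3) unfolding elem_prod_snoc set_mult_def by blast
  moreover have "set (ys @ [y]) \<subseteq> S" "length (x # ys @ [y]) = Suc (Suc n)"
    using xys uy(2) by auto
  ultimately show "z \<in> ms_power S mul (Suc (Suc n))"
    unfolding ms_power_def using xys(1) by blast
qed

lemma idempotent_subset_power:
  assumes "T \<subseteq> S" and "set_mult mul T T = T"
  shows "T \<subseteq> ms_power S mul (Suc n)"
proof (induction n)
  case 0
  show ?case using assms(1) by (simp add: ms_power_1)
next
  case (Suc n)
  have "T = set_mult mul T T" using assms(2) by simp
  also have "\<dots> \<subseteq> set_mult mul (ms_power S mul (Suc n)) S"
    by (intro set_mult_mono Suc.IH assms(1))
  finally show ?case by (simp add: ms_power_Suc_Suc)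
qed

lemma submultisemigroup_mult_subset:
  assumes "submultisemigroup T S mul"
  shows "set_mult mul T T \<subseteq> T"
  using assms unfolding submultisemigroup_def set_mult_def by blast

lemma submultisemigroup_card_less_iff:
  assumes "submultisemigroup T S mul" and "finite S"
  shows "card (set_mult mul T T) < card T \<longleftrightarrow> set_mult mul T T \<noteq> T"
proof -
  have "finite T"
    using assms finite_subset unfolding submultisemigroup_def by blast
  then show ?thesis
    using submultisemigroup_mult_subset[OF assms(1)] psubset_card_mono[of T "set_mult mul T T"]
    by auto
qed

context multisemigroup
begin

lemma set_mult_assoc:
  assumes "A \<subseteq> S" and "B \<subseteq> S" and "C \<subseteq> S"
  shows "set_mult mul (set_mult mul A B) C = set_mult mul A (set_mult mul B C)"
proof -
  have "set_mult mul (set_mult mul A B) C =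
          (\<Union>a\<in>A. \<Union>b\<in>B. \<Union>c\<in>C. set_mult mul (mul a b) {c})"
    unfolding set_mult_def by blast
  also have "\<dots> = (\<Union>a\<in>A. \<Union>b\<in>B. \<Union>c\<in>C. set_mult mul {a} (mul b c))"
    using assms by (intro SUP_cong refl mul_assoc) auto
  also have "\<dots> = set_mult mul A (set_mult mul B C)"
    unfolding set_mult_def by blast
  finally show ?thesis .
qed

lemma ms_power_decreasing:
  "ms_power S mul (Suc (Suc n)) \<subseteq> ms_power S mul (Suc n)"
proof (induction n)
  case 0
  show ?case
    using mul_closed unfolding ms_power_Suc_Suc ms_power_1 set_mult_def by blast
next
  case (Suc n)
  from set_mult_mono[OF this order_refl, of mul S] show ?case
    by (simp only: ms_power_Suc_Suc)
qed

lemma ms_power_subset: "ms_power S mul (Suc n) \<subseteq> S"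
proof (induction n)
  case 0
  show ?case by (simp add: ms_power_1)
next
  case (Suc n)
  with ms_power_decreasing show ?case by (rule order_trans)
qed

text \<open>Absorbing one factor \<open>S\<close> means absorbing any number of them; associativity is what lets the
  factors of \<open>S\<^sup>n\<^sup>+\<^sup>1\<close> be absorbed one at a time.\<close>

lemma mult_power_absorb:
  assumes "T \<subseteq> S" and "set_mult mul T S = T"
  shows "set_mult mul T (ms_power S mul (Suc n)) = T"
proof (induction n)
  case 0
  show ?case using assms(2) by (simp add: ms_power_1)
next
  case (Suc n)
  have "set_mult mul T (ms_power S mul (Suc (Suc n))) =
          set_mult mul (set_mult mul T (ms_power S mul (Suc n))) S"
    unfolding ms_power_Suc_Suc using assms(1) ms_power_subset by (simp add: set_mult_assoc)
  then show ?case using Suc.IH assms(2) by simp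
qed

lemma ex_idempotent_power:
  assumes "finite S"
  shows "\<exists>n. set_mult mul (ms_power S mul (Suc n)) (ms_power S mul (Suc n)) = ms_power S mul (Suc n)"
proof -
  \<comment> \<open>The decreasing chain of powers is stationary from a power of least cardinality on.\<close>
  obtain n where least: "\<And>m. card (ms_power S mul (Suc n)) \<le> card (ms_power S mul (Suc m))"
    using ex_has_least_nat[of "\<lambda>_. True" 0 "\<lambda>m. card (ms_power S mul (Suc m))"] by auto
  have "finite (ms_power S mul (Suc n))"
    using ms_power_subset assms by (rule finite_subset)
  then have "ms_power S mul (Suc (Suc n)) = ms_power S mul (Suc n)"
    using ms_power_decreasing least by (intro card_seteq)
  then have "set_mult mul (ms_power S mul (Suc n)) S = ms_power S mul (Suc n)"
    by (simp add: ms_power_Suc_Suc)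
  then have "set_mult mul (ms_power S mul (Suc n)) (ms_power S mul (Suc n)) = ms_power S mul (Suc n)"
    by (intro mult_power_absorb ms_power_subset)
  then show ?thesis ..
qed

lemma nilpotent_iff_no_idempotent:
  assumes "finite S"
  shows "ms_nilpotent S mul \<longleftrightarrow> (\<forall>T. submultisemigroup T S mul \<longrightarrow> set_mult mul T T \<noteq> T)"
proof
  assume "ms_nilpotent S mul"
  then obtain n where "ms_power S mul (Suc n) = {}"
    unfolding ms_nilpotent_def by (auto dest: Suc_le_D)
  then show "\<forall>T. submultisemigroup T S mul \<longrightarrow> set_mult mul T T \<noteq> T"
    using idempotent_subset_power[of _ S mul n] by (auto simp: submultisemigroup_def)
next
  assume no_idem: "\<forall>T. submultisemigroup T S mul \<longrightarrow> set_mult mul T T \<noteq> T"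
  obtain n where idem:
    "set_mult mul (ms_power S mul (Suc n)) (ms_power S mul (Suc n)) = ms_power S mul (Suc n)"
    using ex_idempotent_power[OF assms] by blast
  then have "\<forall>a\<in>ms_power S mul (Suc n). \<forall>b\<in>ms_power S mul (Suc n). mul a b \<subseteq> ms_power S mul (Suc n)"
    unfolding set_mult_def by blast
  then have "ms_power S mul (Suc n) = {}"
    using no_idem[rule_format, of "ms_power S mul (Suc n)"] idem ms_power_subset[of n]
    by (auto simp only: submultisemigroup_def)
  then show "ms_nilpotent S mul"
    unfolding ms_nilpotent_def by (intro exI[of _ "Suc n"]) simp
qed

end

theorem theorem28:
  fixes S :: "'a set" and mul :: "'a \<Rightarrow> 'a \<Rightarrow> 'a set"
  assumes "multisemigroup S mul" and "finite S"
  shows "(ms_nilpotent S mul \<longleftrightarrow>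
            (\<forall>T. submultisemigroup T S mul \<longrightarrow> card (set_mult mul T T) < card T)) \<and>
         (ms_nilpotent S mul \<longleftrightarrow>
            (\<forall>T. submultisemigroup T S mul \<longrightarrow> set_mult mul T T \<noteq> T)) \<and>
         (\<forall>T. submultisemigroup T S mul \<longrightarrow>
            (card (set_mult mul T T) < card T \<longleftrightarrow> set_mult mul T T \<noteq> T))"
  by (simp add: multisemigroup.nilpotent_iff_no_idempotent[OF assms]
      submultisemigroup_card_less_iff[OF _ assms(2)] cong: imp_cong)

end
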